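(* Let $n\ge 1$ be an integer, let $\theta_1,\dots,\theta_n\in\mathbb{C}$, and let $R_{01},\dots,R_{0n}$ be real numbers with $R_{0k}>0$ for all $k$. Then $$\sum_{j=1}^n R_{0j}\,e^{i\theta_j}=A_n\,e^{\,i\sum_{j=1}^n\theta_j},\qquad\text{where}\qquad A_n=\Big(\prod_{j=1}^n R_{0j}\Big)\Big(\sum_{j=1}^n e^{-i\sum_{k\ne j}\left(-i\ln R_{0k}+\theta_k\right)}\Big).$$
   Context: Here $\ln$ is the real natural logarithm, and $\sum_{k\neq j}$ denotes the sum over all $k\in\{1,\dots,n\}$ with $k\neq j$ (an empty sum is $0$). *)

theory Defs
  imports Complex_Main
begin

(* R k stands for R_{0k}; the logarithm is the real one, embedded into the complex numbers. *)
definition amplitude :: "nat \<Rightarrow> (nat \<Rightarrow> real) \<Rightarrow> (nat \<Rightarrow> complex) \<Rightarrow> complex" where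
  "amplitude n R \<theta> =
     complex_of_real (\<Prod>j=1..n. R j) *
     (\<Sum>j=1..n. exp (- \<i> * (\<Sum>k\<in>{1..n} - {j}. - \<i> * complex_of_real (ln (R k)) + \<theta> k)))"

end

theory Submission
  imports Defs
begin

text \<open>Put \<open>z k = R k * exp (\<i> * \<theta> k)\<close>. Since \<open>R k > 0\<close>, the number \<open>- \<i> * ln (R k) + \<theta> k\<close>,
  multiplied by \<open>\<i>\<close>, is a logarithm of \<open>z k\<close>, so the exponential in the \<open>j\<close>-th summand of the amplitude is
  the product of the reciprocals \<open>1 / z k\<close> over \<open>k \<noteq> j\<close> (\<open>exp_neg_ii_log_polar\<close>). The two factors
  outside that sum, the product of the \<open>R j\<close> and the exponential of the total phase, combine to the
  product of all the \<open>z k\<close>. Multiplying the one by the other leaves exactly \<open>z j\<close>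
  (\<open>prod_mult_sum_prod_inverse\<close>), and summing over \<open>j\<close> gives the claim.\<close>

text \<open>In the \<open>j\<close>-th summand every factor of the full product cancels except the one at \<open>j\<close>.\<close>

lemma prod_mult_sum_prod_inverse:
  fixes z :: "'a \<Rightarrow> 'b::field"
  assumes "finite A" and "\<And>k. k \<in> A \<Longrightarrow> z k \<noteq> 0"
  shows "(\<Prod>k\<in>A. z k) * (\<Sum>j\<in>A. \<Prod>k\<in>A - {j}. inverse (z k)) = (\<Sum>j\<in>A. z j)"
proof -
  have "(\<Prod>k\<in>A. z k) * (\<Prod>k\<in>A - {j}. inverse (z k)) = z j" if "j \<in> A" for j
  proof -
    have "(\<Prod>k\<in>A. z k) = z j * (\<Prod>k\<in>A - {j}. z k)"
      using assms(1) that by (rule prod.remove)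
    moreover have "(\<Prod>k\<in>A - {j}. z k) * (\<Prod>k\<in>A - {j}. inverse (z k)) = 1"
      unfolding prod.distrib [symmetric] using assms(2) by (intro prod.neutral) simp
    ultimately show ?thesis
      by (simp add: mult.assoc)
  qed
  then show ?thesis
    by (simp add: sum_distrib_left)
qed

lemma exp_neg_ii_log_polar:
  fixes r :: real and t :: complex
  assumes "r > 0"
  shows "exp (- \<i> * (- \<i> * complex_of_real (ln r) + t)) = inverse (complex_of_real r * exp (\<i> * t))"
proof -
  have "- \<i> * (- \<i> * complex_of_real (ln r) + t) = - (complex_of_real (ln r) + \<i> * t)"
    by (simp add: algebra_simps)
  moreover have "exp (complex_of_real (ln r)) = complex_of_real r"
    using assms by (simp add: exp_of_real)
  ultimately show ?thesis
    by (simp only: exp_minus exp_add)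
qed

theorem proposition2p1:
  fixes n :: nat and R :: "nat \<Rightarrow> real" and \<theta> :: "nat \<Rightarrow> complex"
  assumes "n \<ge> 1"
    and "\<And>k. k \<in> {1..n} \<Longrightarrow> R k > 0"
  shows "(\<Sum>j=1..n. complex_of_real (R j) * exp (\<i> * \<theta> j))
         = amplitude n R \<theta> * exp (\<i> * (\<Sum>j=1..n. \<theta> j))"
proof -
  define z where "z k = complex_of_real (R k) * exp (\<i> * \<theta> k)" for k
  have nonzero: "z k \<noteq> 0" if "k \<in> {1..n}" for k
    using assms(2) [OF that] by (simp add: z_def)
  have summand: "exp (- \<i> * (\<Sum>k\<in>{1..n} - {j}. - \<i> * complex_of_real (ln (R k)) + \<theta> k))
      = (\<Prod>k\<in>{1..n} - {j}. inverse (z k))" for j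
  proof -
    have "exp (- \<i> * (\<Sum>k\<in>{1..n} - {j}. - \<i> * complex_of_real (ln (R k)) + \<theta> k))
        = (\<Prod>k\<in>{1..n} - {j}. exp (- \<i> * (- \<i> * complex_of_real (ln (R k)) + \<theta> k)))"
      by (simp only: sum_distrib_left exp_sum finite_Diff finite_atLeastAtMost)
    also have "\<dots> = (\<Prod>k\<in>{1..n} - {j}. inverse (z k))"
      unfolding z_def using assms(2) by (intro prod.cong refl exp_neg_ii_log_polar) blast
    finally show ?thesis .
  qed
  have total: "complex_of_real (\<Prod>j=1..n. R j) * exp (\<i> * (\<Sum>j=1..n. \<theta> j)) = (\<Prod>k=1..n. z k)"
    by (simp only: z_def prod.distrib sum_distrib_left exp_sum finite_atLeastAtMost of_real_prod)
  have "amplitude n R \<theta> * exp (\<i> * (\<Sum>j=1..n. \<theta> j))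
      = (\<Prod>k=1..n. z k) * (\<Sum>j=1..n. \<Prod>k\<in>{1..n} - {j}. inverse (z k))"
    unfolding amplitude_def summand total [symmetric] by (simp only: ac_simps)
  also have "\<dots> = (\<Sum>j=1..n. z j)"
    using nonzero by (intro prod_mult_sum_prod_inverse) auto
  finally show ?thesis
    by (simp add: z_def)
qed

end
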